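(* Let $A$ be an injective self-adjoint compact operator on $L^2[a,b]$ with eigenvalues $1\geqslant\lambda_1>\lambda_2>\cdots>0$, $\lim_{k\to\infty}\lambda_k=0$, and corresponding orthonormal basis of eigenfunctions $\{\psi_k\}_{k\geqslant1}$ of $L^2[a,b]$. Let $f\in L^2[a,b]$ and, for each $\varepsilon>0$, let $\bar g=\bar g^{(\varepsilon)}\in\mathrm{Range}(A)$ be such that $$\|Af-\bar g\|_{L^2[a,b]}\leqslant\varepsilon,\qquad \|f\|_{L^2[a,b]}\leqslant 1 .$$ Let $f_*=f_*^{(\varepsilon)}=\sum_{k=1}^{k_0(\varepsilon)}\frac{\bar g_k}{\lambda_k}\psi_k$, where $\bar g_k=(\bar g,\psi_k)$ and $k_0(\varepsilon)$ is the largest integer $k$ such that $\lambda_k\geqslant\varepsilon$. Then $$\lim_{\varepsilon\to0}(f-f_*,v)=0\qquad\text{for all } v\in L^2[a,b] \text{ with } \|v\|_{L^2[a,b]}\leqslant 1 .$$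
   Context: $(\cdot,\cdot)$ is the scalar product of $L^2[a,b]$. The function $\bar g$ is the noisy data function at noise level $\varepsilon$. If $\varepsilon>\lambda_1$, then $k_0(\varepsilon)=0$ and $f_*=0$. *)

theory Defs
  imports "HOL-Analysis.Analysis"
begin

text \<open>
  Elements of the complex Hilbert space \<open>L\<^sup>2[a,b]\<close> are represented by square-integrable functions
  \<open>real \<Rightarrow> complex\<close>; two such functions represent the same element iff they satisfy \<open>L2_eq\<close>.
  Values outside \<open>{a..b}\<close> are irrelevant.
\<close>

definition L2_space :: "real \<Rightarrow> real \<Rightarrow> (real \<Rightarrow> complex) set" where
  "L2_space a b = {u. u \<in> borel_measurable (lebesgue_on {a..b}) \<and>
                      integrable (lebesgue_on {a..b}) (\<lambda>x. (cmod (u x))\<^sup>2)}"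

definition L2_eq :: "real \<Rightarrow> real \<Rightarrow> (real \<Rightarrow> complex) \<Rightarrow> (real \<Rightarrow> complex) \<Rightarrow> bool" where
  "L2_eq a b u v \<longleftrightarrow> (AE x in lebesgue_on {a..b}. u x = v x)"

definition L2_inner :: "real \<Rightarrow> real \<Rightarrow> (real \<Rightarrow> complex) \<Rightarrow> (real \<Rightarrow> complex) \<Rightarrow> complex" where
  "L2_inner a b u v = (LINT x|lebesgue_on {a..b}. u x * cnj (v x))"

definition L2_norm :: "real \<Rightarrow> real \<Rightarrow> (real \<Rightarrow> complex) \<Rightarrow> real" where
  "L2_norm a b u = sqrt (LINT x|lebesgue_on {a..b}. (cmod (u x))\<^sup>2)"

text \<open>
  Operators act on representatives; the second conjunct makes the operator well defined on
  equivalence classes.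
\<close>

definition L2_linear :: "real \<Rightarrow> real \<Rightarrow> ((real \<Rightarrow> complex) \<Rightarrow> real \<Rightarrow> complex) \<Rightarrow> bool" where
  "L2_linear a b A \<longleftrightarrow>
     (\<forall>u\<in>L2_space a b. A u \<in> L2_space a b) \<and>
     (\<forall>u\<in>L2_space a b. \<forall>v\<in>L2_space a b. L2_eq a b u v \<longrightarrow> L2_eq a b (A u) (A v)) \<and>
     (\<forall>u\<in>L2_space a b. \<forall>v\<in>L2_space a b.
        L2_eq a b (A (\<lambda>x. u x + v x)) (\<lambda>x. A u x + A v x)) \<and>
     (\<forall>c. \<forall>u\<in>L2_space a b. L2_eq a b (A (\<lambda>x. c * u x)) (\<lambda>x. c * A u x))"

definition L2_injective :: "real \<Rightarrow> real \<Rightarrow> ((real \<Rightarrow> complex) \<Rightarrow> real \<Rightarrow> complex) \<Rightarrow> bool" where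
  "L2_injective a b A \<longleftrightarrow>
     (\<forall>u\<in>L2_space a b. \<forall>v\<in>L2_space a b. L2_eq a b (A u) (A v) \<longrightarrow> L2_eq a b u v)"

definition L2_self_adjoint :: "real \<Rightarrow> real \<Rightarrow> ((real \<Rightarrow> complex) \<Rightarrow> real \<Rightarrow> complex) \<Rightarrow> bool" where
  "L2_self_adjoint a b A \<longleftrightarrow>
     (\<forall>u\<in>L2_space a b. \<forall>v\<in>L2_space a b. L2_inner a b (A u) v = L2_inner a b u (A v))"

definition L2_compact :: "real \<Rightarrow> real \<Rightarrow> ((real \<Rightarrow> complex) \<Rightarrow> real \<Rightarrow> complex) \<Rightarrow> bool" where
  "L2_compact a b A \<longleftrightarrow>
     (\<forall>u::nat \<Rightarrow> real \<Rightarrow> complex.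
        (\<forall>n. u n \<in> L2_space a b) \<and> (\<exists>C. \<forall>n. L2_norm a b (u n) \<le> C) \<longrightarrow>
        (\<exists>r w. strict_mono r \<and> w \<in> L2_space a b \<and>
           (\<lambda>n. L2_norm a b (\<lambda>x. A (u (r n)) x - w x)) \<longlonglongrightarrow> 0))"

definition L2_range ::
  "real \<Rightarrow> real \<Rightarrow> ((real \<Rightarrow> complex) \<Rightarrow> real \<Rightarrow> complex) \<Rightarrow> (real \<Rightarrow> complex) set" where
  "L2_range a b A = {w\<in>L2_space a b. \<exists>u\<in>L2_space a b. L2_eq a b (A u) w}"

definition L2_eigenfunction ::
  "real \<Rightarrow> real \<Rightarrow> ((real \<Rightarrow> complex) \<Rightarrow> real \<Rightarrow> complex) \<Rightarrow> complex \<Rightarrow> (real \<Rightarrow> complex) \<Rightarrow> bool" where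
  "L2_eigenfunction a b A \<mu> u \<longleftrightarrow>
     u \<in> L2_space a b \<and> \<not> L2_eq a b u (\<lambda>x. 0) \<and> L2_eq a b (A u) (\<lambda>x. \<mu> * u x)"

text \<open>
  Sequences of eigenvalues and eigenfunctions are indexed by \<open>k \<ge> 1\<close>; the entry at \<open>0\<close> is unused.
  Completeness of the orthonormal system is density of its linear span.
\<close>

definition L2_orthonormal_basis :: "real \<Rightarrow> real \<Rightarrow> (nat \<Rightarrow> real \<Rightarrow> complex) \<Rightarrow> bool" where
  "L2_orthonormal_basis a b \<psi> \<longleftrightarrow>
     (\<forall>k\<ge>1. \<psi> k \<in> L2_space a b) \<and>
     (\<forall>j\<ge>1. \<forall>k\<ge>1. L2_inner a b (\<psi> j) (\<psi> k) = (if j = k then 1 else 0)) \<and>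
     (\<forall>u\<in>L2_space a b. \<forall>e>0. \<exists>n c. L2_norm a b (\<lambda>x. u x - (\<Sum>k=1..n. c k * \<psi> k x)) < e)"

definition trunc_index :: "(nat \<Rightarrow> real) \<Rightarrow> real \<Rightarrow> nat" where
  "trunc_index l \<epsilon> = (if \<epsilon> > l 1 then 0 else (GREATEST k. k \<ge> 1 \<and> l k \<ge> \<epsilon>))"

definition trunc_solution ::
  "real \<Rightarrow> real \<Rightarrow> (nat \<Rightarrow> real) \<Rightarrow> (nat \<Rightarrow> real \<Rightarrow> complex) \<Rightarrow> real \<Rightarrow> (real \<Rightarrow> complex) \<Rightarrow> real \<Rightarrow> complex" where
  "trunc_solution a b l \<psi> \<epsilon> g =
     (\<lambda>x. \<Sum>k=1..trunc_index l \<epsilon>. (L2_inner a b g (\<psi> k) / of_real (l k)) * \<psi> k x)"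

end

theory Submission
  imports Defs
begin

text \<open>
  Truncating the eigenfunction expansion at the noise level keeps the error bounded, and it makes
  each single coefficient of the error small; in a Hilbert space these two facts together give weak
  convergence.

  In detail, let \<open>h = A f - g\<close> be the data error, so \<open>\<parallel>h\<parallel> \<le> \<epsilon>\<close>, and let \<open>e = f - f\<^sub>*\<close>. As \<open>A\<close> is
  self-adjoint, \<open>(A f, \<psi>\<^sub>k) = \<lambda>\<^sub>k (f, \<psi>\<^sub>k)\<close>, so below the truncation index
  \<open>(e, \<psi>\<^sub>k) = (h, \<psi>\<^sub>k) / \<lambda>\<^sub>k\<close>, where \<open>\<lambda>\<^sub>k \<ge> \<epsilon>\<close>. Two consequences follow.

  \<^item> The noise is amplified by at most \<open>1 / \<epsilon>\<close>, so by Bessel's inequality its total contribution to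
    \<open>\<parallel>e\<parallel>\<^sup>2\<close> is at most \<open>\<parallel>h\<parallel>\<^sup>2 / \<epsilon>\<^sup>2 \<le> 1\<close>. The discarded tail of \<open>f\<close> contributes at most
    \<open>\<parallel>f\<parallel>\<^sup>2 \<le> 1\<close>. Hence \<open>\<parallel>e\<parallel>\<^sup>2 \<le> 2\<close> uniformly in \<open>\<epsilon>\<close>
    (\<open>L2_norm_error_trunc_solution_le\<close>). Strong convergence cannot be expected, because the first
    contribution need not become small.
  \<^item> For fixed \<open>k\<close>, the index \<open>k\<close> is eventually below the truncation index, and then
    \<open>\<bar>(e, \<psi>\<^sub>k)\<bar> \<le> \<epsilon> / \<lambda>\<^sub>k\<close>, which tends to \<open>0\<close> (\<open>coefficient_error_trunc_solution_tendsto_0\<close>).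

  Since the span of the \<open>\<psi>\<^sub>k\<close> is dense, a bounded family whose coefficients tend to \<open>0\<close> tends weakly
  to \<open>0\<close> (\<open>L2_weakly_tendsto_0\<close>). Both Bessel's inequality and the norm bound are read off from one
  identity, \<open>L2_norm_diff_sum_orthonormal\<close>.
\<close>

section \<open>Square-integrable functions as a semi-inner-product space\<close>

lemma L2_space_measurable [measurable_dest]:
  "u \<in> L2_space a b \<Longrightarrow> u \<in> borel_measurable (lebesgue_on {a..b})"
  by (simp add: L2_space_def)

lemma L2_space_integrable_cmod_square:
  "u \<in> L2_space a b \<Longrightarrow> integrable (lebesgue_on {a..b}) (\<lambda>x. (cmod (u x))\<^sup>2)"
  by (simp add: L2_space_def)

lemma L2_space_scale:
  assumes "u \<in> L2_space a b"
  shows "(\<lambda>x. c * u x) \<in> L2_space a b"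
  using assms by (auto simp: L2_space_def norm_mult power_mult_distrib)

lemma L2_space_add:
  assumes u: "u \<in> L2_space a b" and v: "v \<in> L2_space a b"
  shows "(\<lambda>x. u x + v x) \<in> L2_space a b"
proof -
  have bound: "(cmod (u x + v x))\<^sup>2 \<le> 2 * (cmod (u x))\<^sup>2 + 2 * (cmod (v x))\<^sup>2" for x
  proof -
    have "(cmod (u x + v x))\<^sup>2 \<le> (cmod (u x) + cmod (v x))\<^sup>2"
      by (intro power_mono norm_triangle_ineq) simp
    also have "\<dots> \<le> 2 * (cmod (u x))\<^sup>2 + 2 * (cmod (v x))\<^sup>2"
      using sum_squares_bound[of "cmod (u x)" "cmod (v x)"] by (simp add: power2_sum)
    finally show ?thesis .
  qed
  have "integrable (lebesgue_on {a..b}) (\<lambda>x. (cmod (u x + v x))\<^sup>2)"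
  proof (rule Bochner_Integration.integrable_bound)
    show "integrable (lebesgue_on {a..b}) (\<lambda>x. 2 * (cmod (u x))\<^sup>2 + 2 * (cmod (v x))\<^sup>2)"
      using u v by (simp add: L2_space_integrable_cmod_square)
    show "(\<lambda>x. (cmod (u x + v x))\<^sup>2) \<in> borel_measurable (lebesgue_on {a..b})"
      using u v by measurable
    show "AE x in lebesgue_on {a..b}. norm ((cmod (u x + v x))\<^sup>2)
            \<le> norm (2 * (cmod (u x))\<^sup>2 + 2 * (cmod (v x))\<^sup>2)"
      using bound by simp
  qed
  moreover have "(\<lambda>x. u x + v x) \<in> borel_measurable (lebesgue_on {a..b})"
    using u v by measurable
  ultimately show ?thesis by (simp add: L2_space_def)
qed

lemma L2_space_diff:
  assumes "u \<in> L2_space a b" and "v \<in> L2_space a b"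
  shows "(\<lambda>x. u x - v x) \<in> L2_space a b"
  using L2_space_add[OF assms(1) L2_space_scale[OF assms(2), of "-1"]] by simp

lemma L2_space_zero: "(\<lambda>x. 0) \<in> L2_space a b"
  by (simp add: L2_space_def)

lemma L2_space_sum:
  assumes "\<And>k. k \<in> I \<Longrightarrow> u k \<in> L2_space a b"
  shows "(\<lambda>x. \<Sum>k\<in>I. u k x) \<in> L2_space a b"
  using assms
  by (induction I rule: infinite_finite_induct) (auto simp: L2_space_zero intro: L2_space_add)

lemma borel_measurable_cnj [measurable]: "cnj \<in> borel_measurable borel"
  by (intro borel_measurable_continuous_onI continuous_intros)

lemma L2_integrable_mult_cnj:
  assumes u: "u \<in> L2_space a b" and v: "v \<in> L2_space a b"
  shows "integrable (lebesgue_on {a..b}) (\<lambda>x. u x * cnj (v x))"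
proof (rule Bochner_Integration.integrable_bound)
  show "integrable (lebesgue_on {a..b}) (\<lambda>x. (cmod (u x))\<^sup>2 + (cmod (v x))\<^sup>2)"
    using u v by (simp add: L2_space_integrable_cmod_square)
  show "(\<lambda>x. u x * cnj (v x)) \<in> borel_measurable (lebesgue_on {a..b})"
    using u v by measurable
  have "cmod (u x * cnj (v x)) \<le> (cmod (u x))\<^sup>2 + (cmod (v x))\<^sup>2" for x
    using sum_squares_bound[of "cmod (u x)" "cmod (v x)"]
      mult_nonneg_nonneg[OF norm_ge_zero[of "u x"] norm_ge_zero[of "v x"]]
    unfolding norm_mult complex_mod_cnj by linarith
  then show "AE x in lebesgue_on {a..b}. norm (u x * cnj (v x))
               \<le> norm ((cmod (u x))\<^sup>2 + (cmod (v x))\<^sup>2)"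
    by simp
qed

lemma L2_inner_add_left:
  assumes "u \<in> L2_space a b" "v \<in> L2_space a b" "w \<in> L2_space a b"
  shows "L2_inner a b (\<lambda>x. u x + v x) w = L2_inner a b u w + L2_inner a b v w"
  using assms by (simp add: L2_inner_def distrib_right L2_integrable_mult_cnj)

lemma L2_inner_diff_left:
  assumes "u \<in> L2_space a b" "v \<in> L2_space a b" "w \<in> L2_space a b"
  shows "L2_inner a b (\<lambda>x. u x - v x) w = L2_inner a b u w - L2_inner a b v w"
  using assms by (simp add: L2_inner_def left_diff_distrib L2_integrable_mult_cnj)

lemma L2_inner_scale_left: "L2_inner a b (\<lambda>x. c * u x) w = c * L2_inner a b u w"
  by (simp add: L2_inner_def mult.assoc)

lemma L2_inner_zero_left: "L2_inner a b (\<lambda>x. 0) w = 0"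
  by (simp add: L2_inner_def)

lemma cnj_L2_inner: "cnj (L2_inner a b u v) = L2_inner a b v u"
  unfolding L2_inner_def Bochner_Integration.integral_cnj[symmetric] by (simp add: mult.commute)

lemma L2_inner_diff_right:
  assumes "u \<in> L2_space a b" "v \<in> L2_space a b" "w \<in> L2_space a b"
  shows "L2_inner a b w (\<lambda>x. u x - v x) = L2_inner a b w u - L2_inner a b w v"
  using L2_inner_diff_left[OF assms] by (metis cnj_L2_inner complex_cnj_diff)

lemma L2_inner_scale_right: "L2_inner a b w (\<lambda>x. c * u x) = cnj c * L2_inner a b w u"
  by (metis L2_inner_scale_left cnj_L2_inner complex_cnj_mult)

lemma L2_inner_sum_left:
  assumes "\<And>k. k \<in> I \<Longrightarrow> u k \<in> L2_space a b" "w \<in> L2_space a b"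
  shows "L2_inner a b (\<lambda>x. \<Sum>k\<in>I. u k x) w = (\<Sum>k\<in>I. L2_inner a b (u k) w)"
  using assms(1)
  by (induction I rule: infinite_finite_induct)
    (simp_all add: L2_inner_zero_left L2_inner_add_left L2_space_sum assms(2))

lemma L2_inner_lincomb_left:
  assumes "\<And>k. k \<in> I \<Longrightarrow> u k \<in> L2_space a b" "w \<in> L2_space a b"
  shows "L2_inner a b (\<lambda>x. \<Sum>k\<in>I. c k * u k x) w = (\<Sum>k\<in>I. c k * L2_inner a b (u k) w)"
  using assms by (simp add: L2_inner_sum_left L2_space_scale L2_inner_scale_left)

lemma L2_inner_lincomb_right:
  assumes "\<And>k. k \<in> I \<Longrightarrow> u k \<in> L2_space a b" "w \<in> L2_space a b"
  shows "L2_inner a b w (\<lambda>x. \<Sum>k\<in>I. c k * u k x) = (\<Sum>k\<in>I. cnj (c k) * L2_inner a b w (u k))"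
proof -
  have "L2_inner a b w (\<lambda>x. \<Sum>k\<in>I. c k * u k x)
      = cnj (L2_inner a b (\<lambda>x. \<Sum>k\<in>I. c k * u k x) w)"
    by (simp add: cnj_L2_inner)
  also have "\<dots> = (\<Sum>k\<in>I. cnj (c k) * L2_inner a b w (u k))"
    using assms by (simp add: L2_inner_lincomb_left cnj_L2_inner)
  finally show ?thesis .
qed

lemma L2_inner_cong_right:
  assumes "u \<in> L2_space a b" "v \<in> L2_space a b" "w \<in> L2_space a b" and "L2_eq a b u v"
  shows "L2_inner a b w u = L2_inner a b w v"
  unfolding L2_inner_def
proof (rule integral_cong_AE)
  show "AE x in lebesgue_on {a..b}. w x * cnj (u x) = w x * cnj (v x)"
    using assms(4) unfolding L2_eq_def by (rule AE_mp) simp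
  show "(\<lambda>x. w x * cnj (u x)) \<in> borel_measurable (lebesgue_on {a..b})"
    using assms by measurable
  show "(\<lambda>x. w x * cnj (v x)) \<in> borel_measurable (lebesgue_on {a..b})"
    using assms by measurable
qed

lemma L2_inner_self: "L2_inner a b u u = complex_of_real ((L2_norm a b u)\<^sup>2)"
proof -
  have "L2_inner a b u u = (LINT x|lebesgue_on {a..b}. complex_of_real ((cmod (u x))\<^sup>2))"
    unfolding L2_inner_def by (simp add: complex_norm_square[symmetric])
  then show ?thesis by (simp add: L2_norm_def del: of_real_power)
qed

lemma L2_norm_nonneg: "0 \<le> L2_norm a b u"
  by (simp add: L2_norm_def)

text \<open>
  \<open>L2_norm\<close> is only a seminorm on representatives, so dividing by \<open>\<parallel>v\<parallel>\<close> needs care. The form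
  \<open>2 \<bar>(u, v)\<bar> \<le> t \<parallel>u\<parallel>\<^sup>2 + \<parallel>v\<parallel>\<^sup>2 / t\<close>, valid for every \<open>t > 0\<close> by the pointwise inequality of the
  arithmetic and geometric means, avoids this.
\<close>

lemma L2_inner_le_weighted_norms:
  assumes u: "u \<in> L2_space a b" and v: "v \<in> L2_space a b" and t: "t > 0"
  shows "2 * cmod (L2_inner a b u v) \<le> t * (L2_norm a b u)\<^sup>2 + (L2_norm a b v)\<^sup>2 / t"
proof -
  have pointwise: "2 * cmod (u x * cnj (v x)) \<le> t * (cmod (u x))\<^sup>2 + (cmod (v x))\<^sup>2 / t" for x
  proof -
    have "0 \<le> (t * cmod (u x) - cmod (v x))\<^sup>2 / t"
      using t by simp
    also have "\<dots> = t * (cmod (u x))\<^sup>2 + (cmod (v x))\<^sup>2 / t - 2 * cmod (u x * cnj (v x))"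
      using t by (simp add: norm_mult power2_diff field_simps power2_eq_square)
    finally show ?thesis by simp
  qed
  have "2 * cmod (L2_inner a b u v)
      \<le> 2 * (LINT x|lebesgue_on {a..b}. cmod (u x * cnj (v x)))"
    unfolding L2_inner_def by simp
  also have "\<dots> = (LINT x|lebesgue_on {a..b}. 2 * cmod (u x * cnj (v x)))"
    by simp
  also have "\<dots> \<le> (LINT x|lebesgue_on {a..b}. t * (cmod (u x))\<^sup>2 + (cmod (v x))\<^sup>2 / t)"
    using u v L2_integrable_mult_cnj[OF u v] pointwise
    by (intro integral_mono) (auto simp: L2_space_integrable_cmod_square intro!: integrable_norm)
  also have "\<dots> = t * (L2_norm a b u)\<^sup>2 + (L2_norm a b v)\<^sup>2 / t"
    using u v by (simp add: L2_norm_def L2_space_integrable_cmod_square)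
  finally show ?thesis .
qed

section \<open>Orthonormal systems and weak convergence\<close>

text \<open>
  The squared distance from \<open>u\<close> to a combination of an orthonormal system, with the square completed
  in the coefficients. The choice \<open>c k = (u, \<psi> k)\<close> is Bessel's inequality.
\<close>

lemma L2_norm_diff_sum_orthonormal:
  assumes fin: "finite I" and u: "u \<in> L2_space a b"
    and \<psi>: "\<And>k. k \<in> I \<Longrightarrow> \<psi> k \<in> L2_space a b"
    and orth: "\<And>j k. j \<in> I \<Longrightarrow> k \<in> I \<Longrightarrow> L2_inner a b (\<psi> j) (\<psi> k) = (if j = k then 1 else 0)"
  shows "(L2_norm a b (\<lambda>x. u x - (\<Sum>k\<in>I. c k * \<psi> k x)))\<^sup>2
       = (L2_norm a b u)\<^sup>2 - (\<Sum>k\<in>I. (cmod (L2_inner a b u (\<psi> k)))\<^sup>2)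
         + (\<Sum>k\<in>I. (cmod (L2_inner a b u (\<psi> k) - c k))\<^sup>2)"
proof -
  define w where "w = (\<lambda>x. \<Sum>k\<in>I. c k * \<psi> k x)"
  define d where "d k = L2_inner a b u (\<psi> k)" for k
  have w: "w \<in> L2_space a b"
    unfolding w_def by (intro L2_space_sum L2_space_scale \<psi>)
  have uw: "L2_inner a b u w = (\<Sum>k\<in>I. cnj (c k) * d k)"
    unfolding w_def d_def using \<psi> u by (intro L2_inner_lincomb_right) auto
  have wu: "L2_inner a b w u = (\<Sum>k\<in>I. c k * cnj (d k))"
    unfolding w_def d_def using \<psi> u by (simp add: L2_inner_lincomb_left cnj_L2_inner)
  have w\<psi>: "L2_inner a b w (\<psi> k) = c k" if "k \<in> I" for k
  proof -
    have "L2_inner a b w (\<psi> k) = (\<Sum>j\<in>I. c j * L2_inner a b (\<psi> j) (\<psi> k))"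
      unfolding w_def using \<psi> that by (intro L2_inner_lincomb_left) auto
    also have "\<dots> = (\<Sum>j\<in>I. if j = k then c j else 0)"
      using orth that by (intro sum.cong) auto
    finally show ?thesis using fin that by simp
  qed
  have ww: "L2_inner a b w w = (\<Sum>k\<in>I. cnj (c k) * c k)"
  proof -
    have "L2_inner a b w w = (\<Sum>k\<in>I. cnj (c k) * L2_inner a b w (\<psi> k))"
      using \<psi> w by (subst (2) w_def, intro L2_inner_lincomb_right) auto
    then show ?thesis using w\<psi> by simp
  qed
  have "complex_of_real ((L2_norm a b (\<lambda>x. u x - w x))\<^sup>2)
      = L2_inner a b u u - L2_inner a b u w - L2_inner a b w u + L2_inner a b w w"
    unfolding L2_inner_self[symmetric] using u w
    by (simp add: L2_inner_diff_left L2_inner_diff_right L2_space_diff)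
  also have "\<dots> = L2_inner a b u u - (\<Sum>k\<in>I. d k * cnj (d k))
                 + (\<Sum>k\<in>I. (d k - c k) * cnj (d k - c k))"
    by (simp add: uw wu ww algebra_simps sum.distrib sum_subtractf)
  also have "\<dots> = complex_of_real ((L2_norm a b u)\<^sup>2 - (\<Sum>k\<in>I. (cmod (d k))\<^sup>2)
                 + (\<Sum>k\<in>I. (cmod (d k - c k))\<^sup>2))"
    by (simp only: L2_inner_self complex_norm_square[symmetric] of_real_add of_real_diff of_real_sum)
  finally have "(L2_norm a b (\<lambda>x. u x - w x))\<^sup>2 = (L2_norm a b u)\<^sup>2 - (\<Sum>k\<in>I. (cmod (d k))\<^sup>2)
                 + (\<Sum>k\<in>I. (cmod (d k - c k))\<^sup>2)"
    by (simp only: of_real_eq_iff)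
  then show ?thesis unfolding w_def d_def .
qed

lemma L2_bessel_inequality:
  assumes "finite I" and "u \<in> L2_space a b"
    and "\<And>k. k \<in> I \<Longrightarrow> \<psi> k \<in> L2_space a b"
    and "\<And>j k. j \<in> I \<Longrightarrow> k \<in> I \<Longrightarrow> L2_inner a b (\<psi> j) (\<psi> k) = (if j = k then 1 else 0)"
  shows "(\<Sum>k\<in>I. (cmod (L2_inner a b u (\<psi> k)))\<^sup>2) \<le> (L2_norm a b u)\<^sup>2"
  using L2_norm_diff_sum_orthonormal[OF assms, where c = "\<lambda>k. L2_inner a b u (\<psi> k)"]
    zero_le_power2[of "L2_norm a b (\<lambda>x. u x - (\<Sum>k\<in>I. L2_inner a b u (\<psi> k) * \<psi> k x))"]
  by simp

text \<open>
  Against a finite combination of basis elements the inner products tend to \<open>0\<close> termwise; boundedness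
  makes the error of replacing \<open>v\<close> by such a combination uniform along the filter.
\<close>

lemma L2_weakly_tendsto_0:
  assumes basis: "L2_orthonormal_basis a b \<psi>"
    and e: "\<forall>\<^sub>F i in F. e i \<in> L2_space a b \<and> (L2_norm a b (e i))\<^sup>2 \<le> C"
    and coeff: "\<And>k. k \<ge> 1 \<Longrightarrow> ((\<lambda>i. L2_inner a b (e i) (\<psi> k)) \<longlongrightarrow> 0) F"
    and v: "v \<in> L2_space a b"
  shows "((\<lambda>i. L2_inner a b (e i) v) \<longlongrightarrow> 0) F"
proof (rule tendstoI)
  fix \<eta> :: real assume \<eta>: "\<eta> > 0"
  \<comment> \<open>With the weight \<open>t\<close> the bounded factor contributes at most \<open>\<eta> / 2\<close>, and \<open>\<delta>\<close> is what makes the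
    other factor contribute at most \<open>\<eta> / 2\<close> as well; \<open>\<bar>C\<bar> + 1\<close> only ensures positivity.\<close>
  define t where "t = \<eta> / (2 * (\<bar>C\<bar> + 1))"
  define \<delta> where "\<delta> = sqrt (t * \<eta> / 2)"
  have t: "t > 0" using \<eta> by (simp add: t_def)
  then have \<delta>: "\<delta> > 0" using \<eta> by (simp add: \<delta>_def)
  have \<psi>: "\<psi> k \<in> L2_space a b" if "k \<ge> 1" for k
    using basis that by (simp add: L2_orthonormal_basis_def)
  obtain n c where near: "L2_norm a b (\<lambda>x. v x - (\<Sum>k=1..n. c k * \<psi> k x)) < \<delta>"
    using basis v \<delta> unfolding L2_orthonormal_basis_def by meson
  define w where "w = (\<lambda>x. \<Sum>k=1..n. c k * \<psi> k x)"
  have w: "w \<in> L2_space a b"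
    unfolding w_def using \<psi> by (intro L2_space_sum L2_space_scale) auto
  have vw: "(\<lambda>x. v x - w x) \<in> L2_space a b"
    using v w by (rule L2_space_diff)
  have "(L2_norm a b (\<lambda>x. v x - w x))\<^sup>2 \<le> \<delta>\<^sup>2"
    using near by (intro power_mono) (auto simp: w_def L2_norm_nonneg)
  also have "\<delta>\<^sup>2 = t * \<eta> / 2"
    using t \<eta> by (simp add: \<delta>_def)
  finally have vw_small: "(L2_norm a b (\<lambda>x. v x - w x))\<^sup>2 / t \<le> \<eta> / 2"
    using t by (simp add: field_simps)
  have "((\<lambda>i. \<Sum>k=1..n. cnj (c k) * L2_inner a b (e i) (\<psi> k)) \<longlongrightarrow> (\<Sum>k=1..n. cnj (c k) * 0)) F"
    using coeff by (intro tendsto_sum tendsto_mult tendsto_const) auto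
  then have "((\<lambda>i. \<Sum>k=1..n. cnj (c k) * L2_inner a b (e i) (\<psi> k)) \<longlongrightarrow> 0) F"
    by simp
  then have "\<forall>\<^sub>F i in F. cmod (\<Sum>k=1..n. cnj (c k) * L2_inner a b (e i) (\<psi> k)) < \<eta> / 2"
    using \<eta> by (auto dest!: tendstoD[where e = "\<eta> / 2"] simp: dist_norm)
  with e show "\<forall>\<^sub>F i in F. dist (L2_inner a b (e i) v) 0 < \<eta>"
  proof eventually_elim
    case (elim i)
    then have ei: "e i \<in> L2_space a b" and bounded: "(L2_norm a b (e i))\<^sup>2 \<le> C"
      by simp_all
    have "L2_inner a b (e i) w = (\<Sum>k=1..n. cnj (c k) * L2_inner a b (e i) (\<psi> k))"
      unfolding w_def using \<psi> ei by (intro L2_inner_lincomb_right) auto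
    then have finite_part: "cmod (L2_inner a b (e i) w) < \<eta> / 2"
      using elim by simp
    have "t * (L2_norm a b (e i))\<^sup>2 \<le> t * (\<bar>C\<bar> + 1)"
      using bounded t by (intro mult_left_mono) auto
    also have "\<dots> = \<eta> / 2"
      using abs_ge_zero[of C] by (simp add: t_def field_simps)
    finally have "2 * cmod (L2_inner a b (e i) (\<lambda>x. v x - w x)) \<le> \<eta> / 2 + \<eta> / 2"
      using L2_inner_le_weighted_norms[OF ei vw t] vw_small by linarith
    moreover have "L2_inner a b (e i) v = L2_inner a b (e i) (\<lambda>x. v x - w x) + L2_inner a b (e i) w"
      using L2_inner_diff_right[OF v w ei] by simp
    ultimately show ?case
      using finite_part norm_triangle_ineq[of "L2_inner a b (e i) (\<lambda>x. v x - w x)" "L2_inner a b (e i) w"]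
      by simp
  qed
qed

section \<open>The truncated eigenfunction expansion\<close>

text \<open>
  The maximum defining the truncation index exists because \<open>l\<close> tends to \<open>0\<close>; since \<open>l\<close> decreases,
  the indices up to it are exactly those whose eigenvalue reaches the noise level.
\<close>

lemma le_trunc_index_iff:
  assumes dec: "\<And>k. k \<ge> 1 \<Longrightarrow> l (Suc k) < l k" and lim: "l \<longlonglongrightarrow> 0"
    and \<epsilon>: "\<epsilon> > 0" and k: "k \<ge> 1"
  shows "k \<le> trunc_index l \<epsilon> \<longleftrightarrow> \<epsilon> \<le> l k"
proof -
  have mono: "l j \<le> l i" if "1 \<le> i" "i \<le> j" for i j
    using that(2)
  proof (induction rule: dec_induct)
    case (step m)
    then show ?case using dec[of m] that(1) by simp
  qed simp
  show ?thesis
  proof (cases "\<epsilon> > l 1")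
    case True
    then have "l k < \<epsilon>" using mono[of 1 k] k by simp
    then show ?thesis using True k by (simp add: trunc_index_def)
  next
    case False
    let ?P = "\<lambda>k. k \<ge> 1 \<and> l k \<ge> \<epsilon>"
    have index: "trunc_index l \<epsilon> = (GREATEST k. ?P k)"
      using False by (simp add: trunc_index_def)
    obtain N where N: "\<And>n. n \<ge> N \<Longrightarrow> l n < \<epsilon>"
      using order_tendstoD(2)[OF lim \<epsilon>] by (auto simp: eventually_sequentially)
    have bound: "m \<le> N" if "?P m" for m
      using N[of m] that by (cases "m \<le> N") auto
    have "?P (trunc_index l \<epsilon>)"
      unfolding index using False bound by (intro GreatestI_nat[of ?P 1 N]) auto
    moreover have "k \<le> trunc_index l \<epsilon>" if "\<epsilon> \<le> l k"
      unfolding index using k that bound by (intro Greatest_le_nat[of ?P k N]) auto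
    ultimately show ?thesis
      using mono[OF k, of "trunc_index l \<epsilon>"] by auto
  qed
qed

lemma L2_inner_self_adjoint_eigenfunction:
  assumes "L2_linear a b A" and "L2_self_adjoint a b A"
    and "L2_eigenfunction a b A (of_real \<mu>) \<psi>" and "f \<in> L2_space a b"
  shows "L2_inner a b (A f) \<psi> = of_real \<mu> * L2_inner a b f \<psi>"
proof -
  have \<psi>: "\<psi> \<in> L2_space a b" and eq: "L2_eq a b (A \<psi>) (\<lambda>x. of_real \<mu> * \<psi> x)"
    using assms(3) by (auto simp: L2_eigenfunction_def)
  have "A \<psi> \<in> L2_space a b"
    using assms(1) \<psi> by (simp add: L2_linear_def)
  then have "L2_inner a b f (A \<psi>) = L2_inner a b f (\<lambda>x. of_real \<mu> * \<psi> x)"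
    using \<psi> eq assms(4) by (intro L2_inner_cong_right L2_space_scale)
  then show ?thesis
    using assms(2,4) \<psi> by (simp add: L2_self_adjoint_def L2_inner_scale_right)
qed

text \<open>
  The error in a single coefficient is the data error amplified by the reciprocal eigenvalue. It
  enters both the bound on the whole error and the convergence of its coefficients.
\<close>

lemma coefficient_error_eq:
  assumes "L2_linear a b A" and "L2_self_adjoint a b A"
    and "L2_eigenfunction a b A (of_real \<mu>) \<psi>" and "\<mu> \<noteq> 0"
    and f: "f \<in> L2_space a b" and g: "g \<in> L2_space a b"
  shows "L2_inner a b f \<psi> - L2_inner a b g \<psi> / of_real \<mu>
       = L2_inner a b (\<lambda>x. A f x - g x) \<psi> / of_real \<mu>"
proof -
  have "A f \<in> L2_space a b" "\<psi> \<in> L2_space a b"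
    using assms by (auto simp: L2_linear_def L2_eigenfunction_def)
  then have "L2_inner a b (\<lambda>x. A f x - g x) \<psi> = of_real \<mu> * L2_inner a b f \<psi> - L2_inner a b g \<psi>"
    using L2_inner_self_adjoint_eigenfunction[OF assms(1-3) f] g
    by (simp add: L2_inner_diff_left)
  then show ?thesis using \<open>\<mu> \<noteq> 0\<close> by (simp add: field_simps)
qed

lemma trunc_solution_in_L2_space:
  assumes "\<And>k. k \<ge> 1 \<Longrightarrow> \<psi> k \<in> L2_space a b"
  shows "trunc_solution a b l \<psi> \<epsilon> g \<in> L2_space a b"
  unfolding trunc_solution_def using assms by (intro L2_space_sum L2_space_scale) auto

text \<open>
  Of the two units in the bound, one is the energy of \<open>f\<close> and the other the amplified noise: every
  retained eigenvalue is at least \<open>\<epsilon>\<close>, so the noise of norm \<open>\<epsilon>\<close> grows by a factor of at most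
  \<open>1 / \<epsilon>\<close>.
\<close>

lemma L2_norm_error_trunc_solution_le:
  assumes A: "L2_linear a b A" "L2_self_adjoint a b A"
    and dec: "\<And>k. k \<ge> 1 \<Longrightarrow> l (Suc k) < l k" and lim: "l \<longlonglongrightarrow> 0"
    and eig: "\<And>k. k \<ge> 1 \<Longrightarrow> L2_eigenfunction a b A (of_real (l k)) (\<psi> k)"
    and basis: "L2_orthonormal_basis a b \<psi>"
    and f: "f \<in> L2_space a b" and norm_f: "L2_norm a b f \<le> 1"
    and g: "g \<in> L2_space a b" and \<epsilon>: "\<epsilon> > 0"
    and noise: "L2_norm a b (\<lambda>x. A f x - g x) \<le> \<epsilon>"
  shows "(L2_norm a b (\<lambda>x. f x - trunc_solution a b l \<psi> \<epsilon> g x))\<^sup>2 \<le> 2"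
proof -
  let ?I = "{1..trunc_index l \<epsilon>}"
  define h where "h = (\<lambda>x. A f x - g x)"
  have h: "h \<in> L2_space a b"
    unfolding h_def using A f g by (intro L2_space_diff) (auto simp: L2_linear_def)
  have \<psi>: "\<psi> k \<in> L2_space a b" if "k \<in> ?I" for k
    using basis that by (simp add: L2_orthonormal_basis_def)
  have orth: "L2_inner a b (\<psi> j) (\<psi> k) = (if j = k then 1 else 0)" if "j \<in> ?I" "k \<in> ?I" for j k
    using basis that by (simp add: L2_orthonormal_basis_def)
  have large: "\<epsilon> \<le> l k" if "k \<in> ?I" for k
    using le_trunc_index_iff[OF dec lim \<epsilon>, of k] that by simp
  have term_le: "(cmod (L2_inner a b f (\<psi> k) - L2_inner a b g (\<psi> k) / of_real (l k)))\<^sup>2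
      \<le> (cmod (L2_inner a b h (\<psi> k)))\<^sup>2 / \<epsilon>\<^sup>2" if k: "k \<in> ?I" for k
  proof -
    have "L2_inner a b f (\<psi> k) - L2_inner a b g (\<psi> k) / of_real (l k)
        = L2_inner a b h (\<psi> k) / of_real (l k)"
      unfolding h_def using large[OF k] \<epsilon> k by (intro coefficient_error_eq A eig f g) auto
    then have "(cmod (L2_inner a b f (\<psi> k) - L2_inner a b g (\<psi> k) / of_real (l k)))\<^sup>2
        = (cmod (L2_inner a b h (\<psi> k)))\<^sup>2 / (l k)\<^sup>2"
      by (simp add: norm_divide power_divide)
    also have "\<dots> \<le> (cmod (L2_inner a b h (\<psi> k)))\<^sup>2 / \<epsilon>\<^sup>2"
      using large[OF k] \<epsilon> by (intro divide_left_mono power_mono) auto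
    finally show ?thesis .
  qed
  have "(\<Sum>k\<in>?I. (cmod (L2_inner a b f (\<psi> k) - L2_inner a b g (\<psi> k) / of_real (l k)))\<^sup>2)
      \<le> (\<Sum>k\<in>?I. (cmod (L2_inner a b h (\<psi> k)))\<^sup>2) / \<epsilon>\<^sup>2"
    unfolding sum_divide_distrib by (intro sum_mono term_le)
  also have "\<dots> \<le> (L2_norm a b h)\<^sup>2 / \<epsilon>\<^sup>2"
    by (intro divide_right_mono L2_bessel_inequality h \<psi> orth) auto
  also have "\<dots> \<le> \<epsilon>\<^sup>2 / \<epsilon>\<^sup>2"
    using noise by (intro divide_right_mono power_mono) (auto simp: h_def L2_norm_nonneg)
  finally have noise_part:
    "(\<Sum>k\<in>?I. (cmod (L2_inner a b f (\<psi> k) - L2_inner a b g (\<psi> k) / of_real (l k)))\<^sup>2) \<le> 1"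
    using \<epsilon> by simp
  have "(L2_norm a b (\<lambda>x. f x - trunc_solution a b l \<psi> \<epsilon> g x))\<^sup>2
      = (L2_norm a b f)\<^sup>2 - (\<Sum>k\<in>?I. (cmod (L2_inner a b f (\<psi> k)))\<^sup>2)
        + (\<Sum>k\<in>?I. (cmod (L2_inner a b f (\<psi> k) - L2_inner a b g (\<psi> k) / of_real (l k)))\<^sup>2)"
    unfolding trunc_solution_def by (rule L2_norm_diff_sum_orthonormal[OF _ f \<psi> orth]) simp_all
  moreover have "(L2_norm a b f)\<^sup>2 \<le> 1"
    using norm_f L2_norm_nonneg[of a b f] by (simp add: power_le_one)
  moreover have "0 \<le> (\<Sum>k\<in>?I. (cmod (L2_inner a b f (\<psi> k)))\<^sup>2)"
    by (intro sum_nonneg) simp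
  ultimately show ?thesis
    using noise_part by linarith
qed

lemma coefficient_error_trunc_solution_le:
  assumes A: "L2_linear a b A" "L2_self_adjoint a b A"
    and dec: "\<And>k. k \<ge> 1 \<Longrightarrow> l (Suc k) < l k" and lim: "l \<longlonglongrightarrow> 0"
    and eig: "\<And>k. k \<ge> 1 \<Longrightarrow> L2_eigenfunction a b A (of_real (l k)) (\<psi> k)"
    and basis: "L2_orthonormal_basis a b \<psi>"
    and f: "f \<in> L2_space a b"
    and g: "g \<in> L2_space a b" and \<epsilon>: "\<epsilon> > 0"
    and noise: "L2_norm a b (\<lambda>x. A f x - g x) \<le> \<epsilon>"
    and k: "k \<ge> 1" and large: "\<epsilon> \<le> l k"
  shows "cmod (L2_inner a b (\<lambda>x. f x - trunc_solution a b l \<psi> \<epsilon> g x) (\<psi> k)) \<le> \<epsilon> / l k"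
proof -
  let ?I = "{1..trunc_index l \<epsilon>}"
  have \<psi>: "\<psi> j \<in> L2_space a b" if "j \<ge> 1" for j
    using basis that by (simp add: L2_orthonormal_basis_def)
  have h: "(\<lambda>x. A f x - g x) \<in> L2_space a b"
    using A f g by (intro L2_space_diff) (auto simp: L2_linear_def)
  have kI: "k \<in> ?I"
    using le_trunc_index_iff[OF dec lim \<epsilon> k] k large by simp
  have "L2_inner a b (trunc_solution a b l \<psi> \<epsilon> g) (\<psi> k)
      = (\<Sum>j\<in>?I. L2_inner a b g (\<psi> j) / of_real (l j) * L2_inner a b (\<psi> j) (\<psi> k))"
    unfolding trunc_solution_def using \<psi> k by (intro L2_inner_lincomb_left) auto
  also have "\<dots> = (\<Sum>j\<in>?I. if j = k then L2_inner a b g (\<psi> j) / of_real (l j) else 0)"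
    using basis k by (intro sum.cong) (auto simp: L2_orthonormal_basis_def)
  finally have "L2_inner a b (trunc_solution a b l \<psi> \<epsilon> g) (\<psi> k)
      = L2_inner a b g (\<psi> k) / of_real (l k)"
    using kI by simp
  then have "L2_inner a b (\<lambda>x. f x - trunc_solution a b l \<psi> \<epsilon> g x) (\<psi> k)
      = L2_inner a b f (\<psi> k) - L2_inner a b g (\<psi> k) / of_real (l k)"
    using f k \<psi> trunc_solution_in_L2_space[of \<psi> a b, OF \<psi>] by (simp add: L2_inner_diff_left)
  also have "\<dots> = L2_inner a b (\<lambda>x. A f x - g x) (\<psi> k) / of_real (l k)"
    using large \<epsilon> k by (intro coefficient_error_eq A eig f g) auto
  finally have eq: "cmod (L2_inner a b (\<lambda>x. f x - trunc_solution a b l \<psi> \<epsilon> g x) (\<psi> k))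
      = cmod (L2_inner a b (\<lambda>x. A f x - g x) (\<psi> k)) / l k"
    using large \<epsilon> by (simp add: norm_divide)
  \<comment> \<open>Bessel's inequality for the single unit vector \<open>\<psi> k\<close> is the Cauchy-Schwarz inequality.\<close>
  have "(cmod (L2_inner a b (\<lambda>x. A f x - g x) (\<psi> k)))\<^sup>2 \<le> (L2_norm a b (\<lambda>x. A f x - g x))\<^sup>2"
    using L2_bessel_inequality[of "{k}", OF _ h, of \<psi>] basis k \<psi>
    by (simp add: L2_orthonormal_basis_def)
  then have "cmod (L2_inner a b (\<lambda>x. A f x - g x) (\<psi> k)) \<le> \<epsilon>"
    using noise power2_le_imp_le[OF _ L2_norm_nonneg] by (meson order_trans)
  then show ?thesis
    unfolding eq using large \<epsilon> by (intro divide_right_mono) auto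
qed

lemma coefficient_error_trunc_solution_tendsto_0:
  assumes A: "L2_linear a b A" "L2_self_adjoint a b A"
    and dec: "\<And>k. k \<ge> 1 \<Longrightarrow> l (Suc k) < l k" and lim: "l \<longlonglongrightarrow> 0"
    and eig: "\<And>k. k \<ge> 1 \<Longrightarrow> L2_eigenfunction a b A (of_real (l k)) (\<psi> k)"
    and basis: "L2_orthonormal_basis a b \<psi>"
    and f: "f \<in> L2_space a b"
    and g: "\<And>\<epsilon>. \<epsilon> > 0 \<Longrightarrow> g \<epsilon> \<in> L2_space a b"
    and noise: "\<And>\<epsilon>. \<epsilon> > 0 \<Longrightarrow> L2_norm a b (\<lambda>x. A f x - g \<epsilon> x) \<le> \<epsilon>"
    and k: "k \<ge> 1" and pos: "0 < l k"
  shows "((\<lambda>\<epsilon>. L2_inner a b (\<lambda>x. f x - trunc_solution a b l \<psi> \<epsilon> (g \<epsilon>) x) (\<psi> k)) \<longlongrightarrow> 0) (at_right 0)"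
proof (rule Lim_null_comparison)
  show "((\<lambda>\<epsilon>. \<epsilon> / l k) \<longlongrightarrow> 0) (at_right 0)"
    using pos by (auto intro!: tendsto_eq_intros)
  have "\<forall>\<^sub>F \<epsilon> in at_right 0. \<epsilon> \<in> {0<..<l k}"
    using pos by (rule eventually_at_rightI[of 0, rotated]) simp
  then show "\<forall>\<^sub>F \<epsilon> in at_right 0.
      cmod (L2_inner a b (\<lambda>x. f x - trunc_solution a b l \<psi> \<epsilon> (g \<epsilon>) x) (\<psi> k)) \<le> \<epsilon> / l k"
  proof eventually_elim
    case (elim \<epsilon>)
    then show ?case
      by (intro coefficient_error_trunc_solution_le[OF A dec lim eig basis f g _ noise k]) auto
  qed
qed

theorem theorem1:
  fixes a b :: real
    and A :: "(real \<Rightarrow> complex) \<Rightarrow> real \<Rightarrow> complex"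
    and l :: "nat \<Rightarrow> real"
    and \<psi> :: "nat \<Rightarrow> real \<Rightarrow> complex"
    and f :: "real \<Rightarrow> complex"
    and g :: "real \<Rightarrow> real \<Rightarrow> complex"
  assumes "a < b"
    and "L2_linear a b A" and "L2_injective a b A"
    and "L2_self_adjoint a b A" and "L2_compact a b A"
    and "l 1 \<le> 1" and "\<And>k. k \<ge> 1 \<Longrightarrow> l (Suc k) < l k" and "\<And>k. k \<ge> 1 \<Longrightarrow> 0 < l k"
    and "l \<longlonglongrightarrow> 0"
    and "\<And>k. k \<ge> 1 \<Longrightarrow> L2_eigenfunction a b A (of_real (l k)) (\<psi> k)"
    and "L2_orthonormal_basis a b \<psi>"
    and "f \<in> L2_space a b"
    and "\<And>\<epsilon>. \<epsilon> > 0 \<Longrightarrow> g \<epsilon> \<in> L2_range a b A"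
    and "\<And>\<epsilon>. \<epsilon> > 0 \<Longrightarrow> L2_norm a b (\<lambda>x. A f x - g \<epsilon> x) \<le> \<epsilon>"
    and "L2_norm a b f \<le> 1"
  shows "\<forall>v\<in>L2_space a b. L2_norm a b v \<le> 1 \<longrightarrow>
           ((\<lambda>\<epsilon>. L2_inner a b (\<lambda>x. f x - trunc_solution a b l \<psi> \<epsilon> (g \<epsilon>) x) v) \<longlongrightarrow> 0) (at_right 0)"
proof (intro ballI impI)
  fix v assume v: "v \<in> L2_space a b"
  have g: "g \<epsilon> \<in> L2_space a b" if "\<epsilon> > 0" for \<epsilon>
    using assms(13)[OF that] by (simp add: L2_range_def)
  have \<psi>: "\<psi> k \<in> L2_space a b" if "k \<ge> 1" for k
    using assms(10)[OF that] by (simp add: L2_eigenfunction_def)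
  show "((\<lambda>\<epsilon>. L2_inner a b (\<lambda>x. f x - trunc_solution a b l \<psi> \<epsilon> (g \<epsilon>) x) v) \<longlongrightarrow> 0) (at_right 0)"
  proof (rule L2_weakly_tendsto_0[OF assms(11) _ _ v])
    have "\<forall>\<^sub>F \<epsilon> in at_right 0. (0::real) < \<epsilon>"
      by (rule eventually_at_right_less)
    then show "\<forall>\<^sub>F \<epsilon> in at_right 0. (\<lambda>x. f x - trunc_solution a b l \<psi> \<epsilon> (g \<epsilon>) x) \<in> L2_space a b
        \<and> (L2_norm a b (\<lambda>x. f x - trunc_solution a b l \<psi> \<epsilon> (g \<epsilon>) x))\<^sup>2 \<le> 2"
    proof eventually_elim
      case (elim \<epsilon>)
      show ?case
        using L2_norm_error_trunc_solution_le[OF assms(2,4,7,9,10,11,12,15) g[OF elim] elim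
            assms(14)[OF elim]]
          L2_space_diff[OF assms(12) trunc_solution_in_L2_space[OF \<psi>]]
        by simp
    qed
    show "((\<lambda>\<epsilon>. L2_inner a b (\<lambda>x. f x - trunc_solution a b l \<psi> \<epsilon> (g \<epsilon>) x) (\<psi> k)) \<longlongrightarrow> 0)
        (at_right 0)" if "k \<ge> 1" for k
      using coefficient_error_trunc_solution_tendsto_0[OF assms(2,4,7,9,10,11,12) g assms(14) that
          assms(8)[OF that]] .
  qed
qed

end
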